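(* Let $G$ be a strongly-regular graph with parameters $(n,k,a,c)$. Let $D$ be the distance matrix of $G$ and $A$ the adjacency matrix of $G$. Then $D$ is invertible if and only if $$k+c\neq 2a+4,$$ and when $D$ is invertible its inverse is $$D^{-1}=\frac{(2+a-c)I-A}{k+c-2a-4}+\frac{c\,(2k+c-2a-4)}{k\,(k+c-2a-4)\,(2k+c-2a-2)}\,J,$$ where $I$ is the $n\times n$ identity matrix and $J$ is the $n\times n$ all-ones matrix.
   Context: A graph $G$ that is regular but neither complete nor empty is strongly-regular with parameters $(n,k,a,c)$ if it has $n$ vertices, is $k$-regular, every pair of adjacent vertices has exactly $a$ common neighbours, and every pair of distinct non-adjacent vertices has exactly $c$ common neighbours. The distance matrix $D$ of a connected graph has $(u,v)$-entry equal to the graph distance (length of a shortest path) between $u$ and $v$. *)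

theory Defs
  imports "HOL-Analysis.Analysis" "Graph_Theory.Graph_Theory"
begin

text \<open>
  Finite simple graphs are the locale \<open>pair_graph\<close>: an undirected edge \<open>uv\<close> is the pair of arcs
  \<open>(u,v)\<close> and \<open>(v,u)\<close>, so \<open>out_degree\<close> is the usual degree.
\<close>

definition common_neighbours :: "'v pair_pre_digraph \<Rightarrow> 'v \<Rightarrow> 'v \<Rightarrow> 'v set" where
  "common_neighbours G u v = {w \<in> pverts G. (u, w) \<in> parcs G \<and> (v, w) \<in> parcs G}"

definition regular_graph :: "'v pair_pre_digraph \<Rightarrow> nat \<Rightarrow> bool" where
  "regular_graph G k \<longleftrightarrow> pair_graph G \<and> (\<forall>v \<in> pverts G. out_degree (with_proj G) v = k)"

definition strongly_regular_graph ::
  "'v pair_pre_digraph \<Rightarrow> nat \<Rightarrow> nat \<Rightarrow> nat \<Rightarrow> nat \<Rightarrow> bool" where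
  "strongly_regular_graph G n k a c \<longleftrightarrow>
     card (pverts G) = n \<and> regular_graph G k \<and>
     \<not> complete_digraph n (with_proj G) \<and> parcs G \<noteq> {} \<and>
     (\<forall>u \<in> pverts G. \<forall>v \<in> pverts G.
        (u, v) \<in> parcs G \<longrightarrow> card (common_neighbours G u v) = a) \<and>
     (\<forall>u \<in> pverts G. \<forall>v \<in> pverts G.
        u \<noteq> v \<and> (u, v) \<notin> parcs G \<longrightarrow> card (common_neighbours G u v) = c)"

text \<open>Only meaningful if there is a path from \<open>u\<close> to \<open>v\<close>.\<close>

definition graph_dist :: "'v pair_pre_digraph \<Rightarrow> 'v \<Rightarrow> 'v \<Rightarrow> nat" where
  "graph_dist G u v = (LEAST l. \<exists>p. pre_digraph.apath (with_proj G) u p v \<and> length p = l)"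

text \<open>Matrices are indexed by the vertex type and meant for graphs whose vertex set is \<open>UNIV\<close>.\<close>

definition adjacency_matrix :: "'v::finite pair_pre_digraph \<Rightarrow> real ^ 'v ^ 'v" where
  "adjacency_matrix G = (\<chi> u v. if (u, v) \<in> parcs G then 1 else 0)"

definition distance_matrix :: "'v::finite pair_pre_digraph \<Rightarrow> real ^ 'v ^ 'v" where
  "distance_matrix G = (\<chi> u v. real (graph_dist G u v))"

definition all_ones_matrix :: "real ^ 'v::finite ^ 'v" where
  "all_ones_matrix = (\<chi> u v. 1)"

end

theory Submission
  imports Defs
begin

text \<open>
  A connected strongly-regular graph has diameter two, so \<open>D = 2J - 2I - A\<close>. Since \<open>AJ = kJ\<close> and
  \<open>A\<^sup>2 = kI + aA + c(J - I - A)\<close>, the matrix \<open>B = (2 + a - c)I - A\<close> satisfies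
  \<open>DB = (k + c - 2a - 4)I + tJ\<close> for a scalar \<open>t\<close>, while \<open>DJ = (2n - 2 - k)J\<close>. If
  \<open>k + c \<noteq> 2a + 4\<close> this yields the inverse. Otherwise \<open>DB\<close> is a multiple of \<open>J\<close>; an invertible \<open>D\<close>
  would make \<open>B\<close> a multiple of \<open>J\<close> as well, although \<open>B\<close> has both the off-diagonal entry \<open>-1\<close> (at
  an edge) and \<open>0\<close> (at a non-edge).
\<close>

section \<open>Algebra of real matrices\<close>

lemma matrix_mult_add_left: "(A + B) ** C = A ** C + B ** (C :: real ^ 'p ^ 'n)"
  by (simp add: vec_eq_iff matrix_matrix_mult_def distrib_right sum.distrib)

lemma matrix_mult_diff_left: "(A - B) ** C = A ** C - B ** (C :: real ^ 'p ^ 'n)"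
  by (simp add: vec_eq_iff matrix_matrix_mult_def left_diff_distrib sum_subtractf)

lemma matrix_mult_diff_right: "A ** (B - C) = A ** B - A ** (C :: real ^ 'p ^ 'n)"
  by (simp add: vec_eq_iff matrix_matrix_mult_def right_diff_distrib sum_subtractf)

lemma matrix_mult_scaleR_left: "(x *\<^sub>R A) ** B = x *\<^sub>R (A ** (B :: real ^ 'p ^ 'n))"
  by (simp add: vec_eq_iff matrix_matrix_mult_def sum_distrib_left mult.assoc)

lemma matrix_mult_scaleR_right: "A ** (x *\<^sub>R B) = x *\<^sub>R (A ** (B :: real ^ 'p ^ 'n))"
  by (simp add: vec_eq_iff matrix_matrix_mult_def sum_distrib_left mult.left_commute)

lemmas matrix_mult_linear = matrix_mult_add_left matrix_add_ldistrib
  matrix_mult_diff_left matrix_mult_diff_right matrix_mult_scaleR_left matrix_mult_scaleR_right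

text \<open>For square matrices over a field a right inverse is also a left inverse, so a single
  product has to be computed.\<close>

lemma matrix_inv_eqI:
  fixes A B :: "'a::field ^ 'n ^ 'n"
  assumes "A ** B = mat 1"
  shows "invertible A" "matrix_inv A = B"
proof -
  have BA: "B ** A = mat 1"
    using assms by (simp add: matrix_left_right_inverse)
  show inv: "invertible A"
    using assms BA by (auto simp: invertible_def)
  have "matrix_inv A ** A = mat 1"
    using inv unfolding invertible_def matrix_inv_def by (rule someI2_ex) simp
  then have "matrix_inv A = (matrix_inv A ** A) ** B"
    by (metis assms matrix_mul_assoc matrix_mul_rid)
  then show "matrix_inv A = B"
    using \<open>matrix_inv A ** A = mat 1\<close> by simp
qed

lemma ones_mult_ones:
  "all_ones_matrix ** all_ones_matrix = real CARD('v) *\<^sub>R (all_ones_matrix :: real ^ 'v::finite ^ 'v)"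
  by (simp add: vec_eq_iff matrix_matrix_mult_def all_ones_matrix_def)

section \<open>Combinatorics of connected strongly-regular graphs\<close>

locale connected_srg =
  fixes G :: "'v::finite pair_pre_digraph" and n k a c :: nat
  assumes verts: "pverts G = UNIV"
    and srg: "strongly_regular_graph G n k a c"
    and conn: "Digraph_Component.connected (with_proj G)"
begin

abbreviation A :: "real ^ 'v ^ 'v" where "A \<equiv> adjacency_matrix G"
abbreviation D :: "real ^ 'v ^ 'v" where "D \<equiv> distance_matrix G"
abbreviation J :: "real ^ 'v ^ 'v" where "J \<equiv> all_ones_matrix"
abbreviation I :: "real ^ 'v ^ 'v" where "I \<equiv> mat 1"

sublocale pair_graph G
  using srg by (simp add: strongly_regular_graph_def regular_graph_def)

lemma n_eq_card: "n = CARD('v)"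
  using srg verts by (simp add: strongly_regular_graph_def)

lemma arcs_commute: "(u, v) \<in> parcs G \<longleftrightarrow> (v, u) \<in> parcs G"
  using arcs_symmetric by blast

lemma no_loop: "(v, v) \<notin> parcs G"
  using pair_no_loops[of "(v, v)"] by auto

text \<open>By symmetry of the arcs, common neighbours are the midpoints of walks of length two,
  which is what the entries of \<open>A ** A\<close> count.\<close>

lemma common_neighbours_iff:
  "w \<in> common_neighbours G u v \<longleftrightarrow> (u, w) \<in> parcs G \<and> (w, v) \<in> parcs G"
  by (auto simp: common_neighbours_def verts arcs_commute)

lemma card_neighbours: "card {v. (u, v) \<in> parcs G} = k"
proof -
  have "out_arcs (with_proj G) u = Pair u ` {v. (u, v) \<in> parcs G}"
    by (auto simp: out_arcs_def)
  moreover have "out_degree (with_proj G) u = k"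
    using srg verts by (simp add: strongly_regular_graph_def regular_graph_def)
  ultimately show ?thesis
    by (simp add: out_degree_def card_image inj_on_def)
qed

lemma card_common_neighbours:
  "card (common_neighbours G u v) =
    (if u = v then k else if (u, v) \<in> parcs G then a else c)"
proof (cases "u = v")
  case True
  then have "common_neighbours G u v = {w. (u, w) \<in> parcs G}"
    by (auto simp: common_neighbours_iff arcs_commute)
  with True card_neighbours show ?thesis by simp
next
  case False
  with srg verts show ?thesis by (simp add: strongly_regular_graph_def)
qed

lemma edge_exists: "\<exists>u v. (u, v) \<in> parcs G"
  using srg by (auto simp: strongly_regular_graph_def)

lemma non_edge_exists: "\<exists>u v. u \<noteq> v \<and> (u, v) \<notin> parcs G"
proof (rule ccontr)
  assume "\<not> ?thesis"
  then have "parcs G = {(u, v). (u, v) \<in> pverts G \<times> pverts G \<and> u \<noteq> v}"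
    using no_loop verts by auto
  then have "complete_digraph n (with_proj G)"
    by (simp add: complete_digraph_pair_def n_eq_card verts)
  with srg show False by (simp add: strongly_regular_graph_def)
qed

lemma k_pos: "k > 0"
proof -
  obtain u v where "(u, v) \<in> parcs G" using edge_exists by blast
  then have "{v. (u, v) \<in> parcs G} \<noteq> {}" by blast
  then show ?thesis using card_neighbours[of u] by (simp add: card_gt_0_iff flip: card_neighbours[of u])
qed

lemma k_less_n: "k < n"
proof -
  obtain u :: 'v where True by blast
  have "{v. (u, v) \<in> parcs G} \<subset> UNIV" using no_loop[of u] by blast
  then show ?thesis
    unfolding n_eq_card card_neighbours[of u, symmetric] by (intro psubset_card_mono) simp_all
qed

text \<open>If \<open>c = 0\<close>, adjacency-or-equality is transitive, so connectedness makes the graph complete.\<close>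

lemma c_pos: "c > 0"
proof (rule ccontr)
  assume "\<not> c > 0"
  \<comment> \<open>With \<open>c = 0\<close>, distinct non-adjacent \<open>x\<close> and
    \<open>z\<close> have no common neighbour, but \<open>y\<close> would be one.\<close>
  then have trans: "(x, z) \<in> parcs G" if "(x, y) \<in> parcs G" "(y, z) \<in> parcs G" "x \<noteq> z" for x y z
    using that card_common_neighbours[of x z] common_neighbours_iff[of y x z]
    by (auto split: if_splits)
  obtain u v where uv: "u \<noteq> v" "(u, v) \<notin> parcs G" using non_edge_exists by blast
  \<comment> \<open>Connectedness is defined through the symmetric closure, which leaves
    reachability unchanged because the arcs are already symmetric.\<close>
  have "u \<rightarrow>\<^sup>*\<^bsub>mk_symmetric (with_proj G)\<^esub> v"
    using conn verts by (auto simp: connected_def strongly_connected_def)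
  then have "u \<rightarrow>\<^sup>*\<^bsub>with_proj G\<^esub> v"
    using reachable_mk_symmetric_eq[OF pair_sym_arcs] by simp
  then have "u = v \<or> (u, v) \<in> parcs G"
    by (induction rule: reachable_induct) (auto dest: trans)
  with uv show False by blast
qed

lemma graph_dist_eq:
  "graph_dist G u v = (if u = v then 0 else if (u, v) \<in> parcs G then 1 else 2)"
proof -
  have *: "apath u p v \<longleftrightarrow> set p \<subseteq> parcs G \<and> pcas u p v \<and> distinct (pawalk_verts u p)" for u v p
    by (simp add: apath_def awalk_def verts)
  consider "u = v" | "u \<noteq> v" "(u, v) \<in> parcs G" | "u \<noteq> v" "(u, v) \<notin> parcs G" by blast
  then show ?thesis
  proof cases
    case 1
    have "apath u [] v" using 1 by (simp add: *)
    with 1 show ?thesis unfolding graph_dist_def by (auto intro!: Least_eq_0)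
  next
    case 2
    have "apath u [(u, v)] v" using 2 by (simp add: *)
    moreover have "1 \<le> length p" if "apath u p v" for p
      using that 2 by (cases p) (auto simp: *)
    ultimately have "graph_dist G u v = 1"
      unfolding graph_dist_def by (intro Least_equality) (force, blast)
    with 2 show ?thesis by simp
  next
    case 3
    then have "card (common_neighbours G u v) \<noteq> 0"
      using c_pos by (simp add: card_common_neighbours)
    then have "common_neighbours G u v \<noteq> {}" by auto
    then obtain w where w: "(u, w) \<in> parcs G" "(w, v) \<in> parcs G"
      by (auto simp: common_neighbours_iff)
    then have "apath u [(u, w), (w, v)] v" using 3 no_loop by (auto simp: *)
    \<comment> \<open>A path of length 0 would force \<open>u = v\<close>, and one of length 1 would
      be the missing arc \<open>(u, v)\<close>.\<close>
    moreover have "2 \<le> length p" if "apath u p v" for p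
    proof (cases p)
      case (Cons e es)
      with that 3 show ?thesis by (cases es) (auto simp: *)
    qed (use that 3 in \<open>simp add: *\<close>)
    ultimately have "graph_dist G u v = 2"
      unfolding graph_dist_def by (intro Least_equality) (force, blast)
    with 3 show ?thesis by simp
  qed
qed

section \<open>Matrix identities for adjacency and distance\<close>

lemma distance_matrix_eq: "D = 2 *\<^sub>R J - 2 *\<^sub>R I - A"
  by (auto simp: vec_eq_iff distance_matrix_def adjacency_matrix_def all_ones_matrix_def mat_def
      graph_dist_eq no_loop)

lemma adjacency_mult_ones: "A ** J = real k *\<^sub>R J"
  using card_neighbours
  by (simp add: vec_eq_iff matrix_matrix_mult_def adjacency_matrix_def all_ones_matrix_def
      sum.If_cases)

lemma ones_mult_adjacency: "J ** A = real k *\<^sub>R J"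
  using card_neighbours
  by (simp add: vec_eq_iff matrix_matrix_mult_def adjacency_matrix_def all_ones_matrix_def
      sum.If_cases arcs_commute)

lemma adjacency_square: "A ** A = (real k - real c) *\<^sub>R I + (real a - real c) *\<^sub>R A + real c *\<^sub>R J"
proof -
  have "(A ** A) $ u $ v = real (card (common_neighbours G u v))" for u v
  proof -
    have "(A ** A) $ u $ v = (\<Sum>w\<in>UNIV. if w \<in> common_neighbours G u v then 1 else 0)"
      unfolding matrix_matrix_mult_def
      by (auto simp: adjacency_matrix_def common_neighbours_iff intro!: sum.cong)
    then show ?thesis by (simp add: sum.If_cases)
  qed
  then show ?thesis
    by (auto simp: vec_eq_iff card_common_neighbours adjacency_matrix_def all_ones_matrix_def
        mat_def no_loop)
qed

text \<open>This is \<open>k(k - a - 1) = c(n - k - 1)\<close>, obtained by evaluating \<open>A\<^sup>2J\<close> in two ways.\<close>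

lemma parameter_identity:
  "real k * (2 * real k + real c - 2 * real a - 2) = real c * (2 * real n - 2 - real k)"
proof -
  have "(A ** A) ** J = (real k * real k) *\<^sub>R J"
    by (simp add: adjacency_mult_ones matrix_mult_linear flip: matrix_mul_assoc)
  moreover have "(A ** A) ** J =
      ((real k - real c) + (real a - real c) * real k + real c * real n) *\<^sub>R J"
    unfolding adjacency_square
    by (simp add: matrix_mult_linear adjacency_mult_ones ones_mult_ones
        n_eq_card scaleR_add_left)
  moreover have "J \<noteq> 0" by (simp add: vec_eq_iff all_ones_matrix_def)
  ultimately have "real k * real k = (real k - real c) + (real a - real c) * real k + real c * real n"
    by simp
  then show ?thesis by (simp add: algebra_simps)
qed

lemma distance_mult_ones: "D ** J = (2 * real n - 2 - real k) *\<^sub>R J"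
  unfolding distance_matrix_eq
  by (simp add: matrix_mult_linear adjacency_mult_ones ones_mult_ones n_eq_card)
    (simp add: algebra_simps flip: scaleR_add_left)

lemma distance_mult:
  "D ** ((2 + real a - real c) *\<^sub>R I - A) =
    (real k + real c - 2 * real a - 4) *\<^sub>R I + (4 + 2 * real a - real c - 2 * real k) *\<^sub>R J"
  unfolding distance_matrix_eq
  by (simp add: matrix_mult_linear adjacency_square ones_mult_adjacency)
    (simp add: vec_eq_iff algebra_simps)

section \<open>Inverse and singularity of the distance matrix\<close>

lemma row_sum_pos: "2 * real n - 2 - real k > 0"
  \<comment> \<open>From \<open>n \<ge> k + 1\<close> the left side is at least
    \<open>k\<close>.\<close>
  using k_less_n k_pos by linarith

text \<open>In the notation \<open>q\<close>, \<open>r\<close>, \<open>s\<close> of the proof, the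
  \<open>J\<close> term left by the first summand is cancelled by the coefficient
  \<open>(s - 2) / (q * r)\<close>. The identity \<open>k * s = c * r\<close> replaces
  \<open>1 / r\<close> by \<open>c / (k * s)\<close>, which eliminates \<open>n\<close>.\<close>

lemma distance_inverse:
  assumes "real k + real c - 2 * real a - 4 \<noteq> 0"
  shows "D ** ((1 / (real k + real c - 2 * real a - 4)) *\<^sub>R ((2 + real a - real c) *\<^sub>R I - A)
        + (real c * (2 * real k + real c - 2 * real a - 4)
           / (real k * (real k + real c - 2 * real a - 4)
              * (2 * real k + real c - 2 * real a - 2))) *\<^sub>R J) = I"
proof -
  define q r s where "q = real k + real c - 2 * real a - 4"
    and "r = 2 * real n - 2 - real k"
    and "s = 2 * real k + real c - 2 * real a - 2"
  have s2: "2 * real k + real c - 2 * real a - 4 = s - 2"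
    by (simp add: s_def)
  have DB: "D ** ((2 + real a - real c) *\<^sub>R I - A) = q *\<^sub>R I - (s - 2) *\<^sub>R J"
    unfolding distance_mult by (simp add: q_def s_def vec_eq_iff algebra_simps)
  have DJ: "D ** J = r *\<^sub>R J"
    using distance_mult_ones by (simp add: r_def)
  have rs: "real k * s = real c * r" and "r \<noteq> 0" "q \<noteq> 0"
    using parameter_identity row_sum_pos assms by (simp_all add: q_def r_def s_def)
  have pos: "real k \<noteq> 0" "real c \<noteq> 0" using k_pos c_pos by auto
  have coeff: "real c * (s - 2) / (real k * q * s) * r = (s - 2) / q"
  proof -
    have "real c * (s - 2) / (real k * q * s) * r = (real c * r) * (s - 2) / (q * (real k * s))"
      by (simp add: mult_ac)
    also have "\<dots> = (s - 2) / q"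
      unfolding rs using pos \<open>r \<noteq> 0\<close> by simp
    finally show ?thesis .
  qed
  have "D ** ((1 / q) *\<^sub>R ((2 + real a - real c) *\<^sub>R I - A)
      + (real c * (s - 2) / (real k * q * s)) *\<^sub>R J)
    = (1 / q) *\<^sub>R (q *\<^sub>R I - (s - 2) *\<^sub>R J) + (real c * (s - 2) / (real k * q * s) * r) *\<^sub>R J"
    by (simp only: matrix_add_ldistrib matrix_mult_scaleR_right DB DJ scaleR_scaleR)
  also have "\<dots> = I"
    unfolding coeff using \<open>q \<noteq> 0\<close> by (simp add: scaleR_diff_right)
  finally show ?thesis
    unfolding s2 by (simp only: q_def s_def)
qed

lemma distance_singular:
  assumes "real k + real c - 2 * real a - 4 = 0"
  shows "\<not> invertible D"
proof
  assume "invertible D"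
  then obtain E where E: "E ** D = I" by (auto simp: invertible_def)
  define r t where "r = 2 * real n - 2 - real k" and "t = 4 + 2 * real a - real c - 2 * real k"
  let ?B = "(2 + real a - real c) *\<^sub>R I - A"
  have "r \<noteq> 0" using row_sum_pos by (simp add: r_def)
  have cancel: "E ** (D ** X) = X" for X :: "real ^ 'v ^ 'v"
    by (simp add: matrix_mul_assoc E)
  \<comment> \<open>As \<open>r \<noteq> 0\<close>, the matrix \<open>t *\<^sub>R J\<close> is
    itself the image of a multiple of \<open>J\<close> under \<open>D\<close>.\<close>
  have "D ** ?B = D ** ((t / r) *\<^sub>R J)"
    using distance_mult distance_mult_ones assms \<open>r \<noteq> 0\<close>
    by (simp add: matrix_mult_scaleR_right r_def t_def)
  then have B: "?B = (t / r) *\<^sub>R J"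
    using cancel by metis
  \<comment> \<open>Off the diagonal \<open>I\<close> vanishes, so all these entries of
    \<open>- A\<close> must agree.\<close>
  have entry: "- A $ u $ v = t / r" if "u \<noteq> v" for u v
    using arg_cong[OF B, of "\<lambda>M. M $ u $ v"] that by (simp add: mat_def all_ones_matrix_def)
  obtain u v where "(u, v) \<in> parcs G" using edge_exists by blast
  with entry[of u v] no_loop have "t / r = - 1" by (fastforce simp: adjacency_matrix_def)
  moreover obtain x y where "x \<noteq> y" "(x, y) \<notin> parcs G" using non_edge_exists by blast
  with entry[of x y] have "t / r = 0" by (simp add: adjacency_matrix_def)
  ultimately show False by simp
qed

end

theorem theorem1:
  fixes G :: "'v::finite pair_pre_digraph" and n k a c :: nat
    and D A I J :: "real ^ 'v ^ 'v"
  assumes "pverts G = UNIV"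
    and "strongly_regular_graph G n k a c"
    and "Digraph_Component.connected (with_proj G)"
  defines "D \<equiv> distance_matrix G"
    and "A \<equiv> adjacency_matrix G"
    and "I \<equiv> mat 1"
    and "J \<equiv> all_ones_matrix"
  shows "(invertible D \<longleftrightarrow> k + c \<noteq> 2 * a + 4) \<and>
    (invertible D \<longrightarrow>
      matrix_inv D =
        (1 / (real k + real c - 2 * real a - 4)) *\<^sub>R ((2 + real a - real c) *\<^sub>R I - A)
        + (real c * (2 * real k + real c - 2 * real a - 4)
           / (real k * (real k + real c - 2 * real a - 4)
              * (2 * real k + real c - 2 * real a - 2))) *\<^sub>R J)"
proof -
  interpret connected_srg G n k a c
    using assms(1-3) by unfold_locales
  have q: "k + c \<noteq> 2 * a + 4 \<longleftrightarrow> real k + real c - 2 * real a - 4 \<noteq> 0"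
    by linarith
  show ?thesis
    unfolding q D_def A_def I_def J_def
    using matrix_inv_eqI[OF distance_inverse] distance_singular by blast
qed

end
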